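(* Any finite-dimensional nilpotent real evolution algebra $E$ is not dibaric.
   Context: An algebra $E$ over a field $K$ is an evolution algebra if it admits a basis $\{e_1,e_2,\dots\}$ (called a natural basis) such that $e_ie_j=0$ for $i\ne j$ and $e_ie_i=\sum_k a_{ik}e_k$. Put $E^1=E$ and $E^k=\sum_{i=1}^{k-1}E^iE^{k-i}$ for $k\ge 2$, where the product of two subspaces is the linear span of all products; $E$ is nilpotent if $E^k=0$ for some $k\in\mathbb N$. The sex differentiation algebra $\mathfrak A$ is the two-dimensional commutative algebra over $\mathbb R$ with basis $\{w,m\}$ and multiplication $w^2=m^2=0$, $wm=\frac12(w+m)$. A real algebra is dibaric if it admits an algebra homomorphism onto $\mathfrak A$. *)

theory Defs
  imports "HOL-Analysis.Linear_Algebra"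
begin

text \<open>
  An algebra here is a real vector space (the whole type) with an arbitrary bilinear product, which
  is passed explicitly because the type class \<^class>\<open>real_algebra\<close> would impose associativity.
\<close>

text \<open>
  The condition that each square be a linear combination of basis vectors is implied by
  \<^term>\<open>span B = UNIV\<close>.
\<close>

definition natural_basis :: "('a::real_vector \<Rightarrow> 'a \<Rightarrow> 'a) \<Rightarrow> 'a set \<Rightarrow> bool" where
  "natural_basis mult B \<longleftrightarrow>
     independent B \<and> span B = UNIV \<and> (\<forall>x\<in>B. \<forall>y\<in>B. x \<noteq> y \<longrightarrow> mult x y = 0)"

definition evolution_algebra :: "('a::real_vector \<Rightarrow> 'a \<Rightarrow> 'a) \<Rightarrow> bool" where
  "evolution_algebra mult \<longleftrightarrow> bilinear mult \<and> (\<exists>B. natural_basis mult B)"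

definition subspace_prod ::
    "('a::real_vector \<Rightarrow> 'a \<Rightarrow> 'a) \<Rightarrow> 'a set \<Rightarrow> 'a set \<Rightarrow> 'a set" where
  "subspace_prod mult U V = span {mult x y | x y. x \<in> U \<and> y \<in> V}"

text \<open>
  For \<open>k \<ge> 2\<close> the right-hand side is the sum of the subspaces \<open>E\<^sup>i E\<^sup>k\<^sup>-\<^sup>i\<close>, \<open>1 \<le> i < k\<close>.
  The index \<open>0\<close> carries no meaning; its value is a dummy.
\<close>

fun alg_power :: "('a::real_vector \<Rightarrow> 'a \<Rightarrow> 'a) \<Rightarrow> nat \<Rightarrow> 'a set" where
  "alg_power mult k =
     (if k \<le> 1 then UNIV
      else {\<Sum>i\<in>{1..<k}. v i | v.
              \<forall>i\<in>{1..<k}. v i \<in> subspace_prod mult (alg_power mult i) (alg_power mult (k - i))})"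

declare alg_power.simps [simp del]

definition nilpotent_algebra :: "('a::real_vector \<Rightarrow> 'a \<Rightarrow> 'a) \<Rightarrow> bool" where
  "nilpotent_algebra mult \<longleftrightarrow> (\<exists>k\<ge>1. alg_power mult k = {0})"

definition finite_dimensional :: "'a::real_vector itself \<Rightarrow> bool" where
  "finite_dimensional _ \<longleftrightarrow> (\<exists>B::'a set. finite B \<and> span B = UNIV)"

text \<open>
  The sex differentiation algebra lives on \<^typ>\<open>real \<times> real\<close>, where \<open>(a, b)\<close> stands for
  \<open>a w + b m\<close>; its product is the bilinear extension of the multiplication table, as
  \<open>sexdiff_mult_table\<close> and \<open>bilinear_sexdiff_mult\<close> confirm.
\<close>

definition sexdiff_w :: "real \<times> real" where "sexdiff_w = (1, 0)"

definition sexdiff_m :: "real \<times> real" where "sexdiff_m = (0, 1)"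

definition sexdiff_mult :: "real \<times> real \<Rightarrow> real \<times> real \<Rightarrow> real \<times> real" where
  "sexdiff_mult x y =
     (fst x * snd y + snd x * fst y) *\<^sub>R ((1 / 2) *\<^sub>R (sexdiff_w + sexdiff_m))"

lemma sexdiff_mult_table:
  "sexdiff_mult sexdiff_w sexdiff_w = 0"
  "sexdiff_mult sexdiff_m sexdiff_m = 0"
  "sexdiff_mult sexdiff_w sexdiff_m = (1 / 2) *\<^sub>R (sexdiff_w + sexdiff_m)"
  "sexdiff_mult sexdiff_m sexdiff_w = (1 / 2) *\<^sub>R (sexdiff_w + sexdiff_m)"
  by (simp_all add: sexdiff_mult_def sexdiff_w_def sexdiff_m_def zero_prod_def)

lemma bilinear_sexdiff_mult: "bilinear sexdiff_mult"
  unfolding bilinear_def sexdiff_mult_def sexdiff_w_def sexdiff_m_def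
  by (auto intro!: linearI simp: algebra_simps add_divide_distrib)

definition algebra_hom ::
    "('a::real_vector \<Rightarrow> 'a \<Rightarrow> 'a) \<Rightarrow> ('b::real_vector \<Rightarrow> 'b \<Rightarrow> 'b) \<Rightarrow> ('a \<Rightarrow> 'b) \<Rightarrow> bool" where
  "algebra_hom multA multB f \<longleftrightarrow> linear f \<and> (\<forall>x y. f (multA x y) = multB (f x) (f y))"

definition dibaric :: "('a::real_vector \<Rightarrow> 'a \<Rightarrow> 'a) \<Rightarrow> bool" where
  "dibaric mult \<longleftrightarrow> (\<exists>f. algebra_hom mult sexdiff_mult f \<and> surj f)"

end

theory Submission imports Defs begin

text \<open>
  The sex differentiation algebra contains a nonzero idempotent, namely \<open>w + m\<close>. Nilpotency cannot
  coexist with a surjective homomorphism \<open>f\<close> onto an algebra having a nonzero idempotent \<open>e\<close>: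
  every power \<open>E\<^sup>k\<close> contains a preimage of \<open>e\<close>. Indeed, if \<open>y \<in> E\<^sup>k\<close> lies over \<open>e\<close>, then
  \<open>y y\<close> belongs to \<open>E E\<^sup>k \<subseteq> E\<^sup>k\<^sup>+\<^sup>1\<close> (lemma \<open>mult_mem_alg_power_Suc\<close>) and lies over \<open>e e = e\<close>.
  Since \<open>f 0 = 0 \<noteq> e\<close>, no power \<open>E\<^sup>k\<close> is zero. The preimages of \<open>e\<close> depend on \<open>k\<close> and are in
  general not idempotent.
\<close>

lemma mult_mem_alg_power_Suc:
  assumes "y \<in> alg_power mult k" and "1 \<le> k"
  shows "mult x y \<in> alg_power mult (Suc k)"
proof -
  \<comment> \<open>The product is the summand of index 1; all other summands are chosen to be zero.\<close>
  define v where "v = (\<lambda>i::nat. if i = 1 then mult x y else 0)"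
  have "alg_power mult 1 = UNIV"
    by (subst alg_power.simps) simp
  with assms have "mult x y \<in> subspace_prod mult (alg_power mult 1) (alg_power mult (Suc k - 1))"
    unfolding subspace_prod_def by (auto intro!: span_base)
  then have "\<forall>i\<in>{1..<Suc k}.
      v i \<in> subspace_prod mult (alg_power mult i) (alg_power mult (Suc k - i))"
    by (auto simp: v_def subspace_prod_def span_zero)
  moreover have "(\<Sum>i\<in>{1..<Suc k}. v i) = mult x y"
    using assms(2) by (simp add: v_def sum.delta)
  ultimately show ?thesis
    using assms(2) by (subst alg_power.simps) force
qed

lemma idempotent_in_image_alg_power:
  assumes hom: "algebra_hom mult mult' f" and "surj f" and idem: "mult' e e = e"
    and "1 \<le> k"
  shows "e \<in> f ` alg_power mult k"
  using \<open>1 \<le> k\<close>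
proof (induction k rule: dec_induct)
  case base
  show ?case
    using \<open>surj f\<close> by (subst alg_power.simps) simp
next
  case (step k)
  then obtain y where y: "y \<in> alg_power mult k" "f y = e"
    by auto
  have "f (mult y y) = e"
    using hom idem y(2) by (simp add: algebra_hom_def)
  with mult_mem_alg_power_Suc[OF y(1) step.hyps(1)] show ?case
    by (metis imageI)
qed

lemma nilpotent_algebra_hom_onto_idempotent_eq_0:
  assumes "nilpotent_algebra mult" and hom: "algebra_hom mult mult' f" and "surj f"
    and "mult' e e = e"
  shows "e = 0"
proof -
  obtain k where "1 \<le> k" "alg_power mult k = {0}"
    using assms(1) by (auto simp: nilpotent_algebra_def)
  with idempotent_in_image_alg_power[of mult mult' f e k] assms have "e = f 0"
    by auto
  also have "f 0 = 0"
    using hom by (simp add: algebra_hom_def linear_0)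
  finally show ?thesis .
qed

lemma sexdiff_idempotent:
  "sexdiff_mult (sexdiff_w + sexdiff_m) (sexdiff_w + sexdiff_m) = sexdiff_w + sexdiff_m"
  by (simp add: sexdiff_mult_def sexdiff_w_def sexdiff_m_def)

theorem theorem4p1:
  fixes mult :: "'a::real_vector \<Rightarrow> 'a \<Rightarrow> 'a"
  assumes "finite_dimensional TYPE('a)"
    and "evolution_algebra mult"
    and "nilpotent_algebra mult"
  shows "\<not> dibaric mult"
proof
  assume "dibaric mult"
  then obtain f where "algebra_hom mult sexdiff_mult f" "surj f"
    by (auto simp: dibaric_def)
  with assms(3) have "sexdiff_w + sexdiff_m = 0"
    using sexdiff_idempotent by (rule nilpotent_algebra_hom_onto_idempotent_eq_0)
  then show False
    by (simp add: sexdiff_w_def sexdiff_m_def zero_prod_def)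
qed

end
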